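(* Let $\lambda\ge1$ and suppose the instance is $\lambda$-balanced. Then the Half-and-Half algorithm with parameter $\lambda$ is $O(\log(\lambda N))$-competitive, i.e., the optimal Nash welfare is at most $O(\log(\lambda N))$ times the Nash welfare of the algorithm's allocation.
   Context: There are $N$ agents and $T$ divisible items arriving online in the order $t=1,\dots,T$. Item $t$ has supply $s_t>0$ and agent $i$ has value $v_{it}\ge 0$ per unit of item $t$. An allocation is a non-negative vector $(x_{it})$ with $\sum_{i} x_{it}\le s_t$; agent $i$'s utility is $u_i=\sum_t x_{it}v_{it}$, and the Nash welfare is $(\prod_{i=1}^N u_i)^{1/N}$. The instance is $\lambda$-balanced if $\sum_t s_tv_{it}\le\lambda\sum_t s_tv_{jt}$ for all agents $i,j$. Logarithms are natural. Half-and-Half with parameter $\lambda$: for each item $t$ in order, let $y_{it}=\frac{s_t}{2N}$ for all $i$; define $u'_{it}=\frac{1}{2\lambda N^2}\sum_{j=1}^N\sum_{t'=1}^{t} v_{jt'}s_{t'}+\sum_{t'=1}^{t-1} v_{it'}z_{it'}$; let $(z_{it})_i$ maximize $\sum_{i=1}^N\log(u'_{it}+v_{it}z_{it})$ subject to $\sum_i z_{it}\le s_t/2$ and $z_{it}\ge 0$; allocate $x_{it}=y_{it}+z_{it}$ to each agent $i$. *)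

theory Defs
  imports Complex_Main
begin

text \<open>
  Agents are \<open>{..<N}\<close> and items are \<open>{..<T}\<close>, arriving in increasing order. \<open>s t\<close> is the supply of
  item \<open>t\<close>, \<open>v i t\<close> the value of agent \<open>i\<close> per unit of item \<open>t\<close>, and \<open>x i t\<close> the amount of item \<open>t\<close>
  given to agent \<open>i\<close>. Values at indices outside these ranges are irrelevant.
\<close>

definition valid_instance :: "nat \<Rightarrow> nat \<Rightarrow> (nat \<Rightarrow> real) \<Rightarrow> (nat \<Rightarrow> nat \<Rightarrow> real) \<Rightarrow> bool" where
  "valid_instance N T s v \<longleftrightarrow>
     N \<ge> 1 \<and> (\<forall>t<T. s t > 0) \<and> (\<forall>i<N. \<forall>t<T. v i t \<ge> 0)"

definition allocation :: "nat \<Rightarrow> nat \<Rightarrow> (nat \<Rightarrow> real) \<Rightarrow> (nat \<Rightarrow> nat \<Rightarrow> real) \<Rightarrow> bool" where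
  "allocation N T s x \<longleftrightarrow>
     (\<forall>i<N. \<forall>t<T. x i t \<ge> 0) \<and> (\<forall>t<T. (\<Sum>i<N. x i t) \<le> s t)"

definition utility :: "nat \<Rightarrow> (nat \<Rightarrow> nat \<Rightarrow> real) \<Rightarrow> (nat \<Rightarrow> nat \<Rightarrow> real) \<Rightarrow> nat \<Rightarrow> real" where
  "utility T v x i = (\<Sum>t<T. x i t * v i t)"

definition nash_welfare ::
    "nat \<Rightarrow> nat \<Rightarrow> (nat \<Rightarrow> nat \<Rightarrow> real) \<Rightarrow> (nat \<Rightarrow> nat \<Rightarrow> real) \<Rightarrow> real" where
  "nash_welfare N T v x = root N (\<Prod>i<N. utility T v x i)"

definition opt_nash_welfare ::
    "nat \<Rightarrow> nat \<Rightarrow> (nat \<Rightarrow> real) \<Rightarrow> (nat \<Rightarrow> nat \<Rightarrow> real) \<Rightarrow> real" where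
  "opt_nash_welfare N T s v = (SUP x\<in>{x. allocation N T s x}. nash_welfare N T v x)"

definition balanced ::
    "real \<Rightarrow> nat \<Rightarrow> nat \<Rightarrow> (nat \<Rightarrow> real) \<Rightarrow> (nat \<Rightarrow> nat \<Rightarrow> real) \<Rightarrow> bool" where
  "balanced lam N T s v \<longleftrightarrow>
     (\<forall>i<N. \<forall>j<N. (\<Sum>t<T. s t * v i t) \<le> lam * (\<Sum>t<T. s t * v j t))"

definition predicted_utility ::
    "real \<Rightarrow> nat \<Rightarrow> (nat \<Rightarrow> real) \<Rightarrow> (nat \<Rightarrow> nat \<Rightarrow> real) \<Rightarrow> (nat \<Rightarrow> nat \<Rightarrow> real) \<Rightarrow> nat \<Rightarrow> nat \<Rightarrow> real" where
  "predicted_utility lam N s v z i t =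
     1 / (2 * lam * (real N)\<^sup>2) * (\<Sum>j<N. \<Sum>t'\<le>t. v j t' * s t') + (\<Sum>t'<t. v i t' * z i t')"

text \<open>
  The maximizer \<open>z\<close> chosen for an item need not be unique (agents of value 0 may receive any unused
  supply), so the algorithm is a relation: \<open>x\<close> is the allocation of some run, with arbitrary
  tie-breaking.

  The convention \<open>ln 0 = 0\<close> instead of \<open>log 0 = -\<infinity>\<close> makes no difference: if an argument of a
  logarithm below vanishes, then all agents have value 0 for all items up to \<open>t\<close>, all these arguments
  vanish for every choice of \<open>w\<close>, and every feasible \<open>w\<close> is a maximizer under either convention.
\<close>

definition half_and_half ::
    "real \<Rightarrow> nat \<Rightarrow> nat \<Rightarrow> (nat \<Rightarrow> real) \<Rightarrow> (nat \<Rightarrow> nat \<Rightarrow> real) \<Rightarrow> (nat \<Rightarrow> nat \<Rightarrow> real) \<Rightarrow> bool" where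
  "half_and_half lam N T s v x \<longleftrightarrow>
     (\<exists>z. \<forall>t<T.
        is_arg_max
          (\<lambda>w. \<Sum>i<N. ln (predicted_utility lam N s v z i t + v i t * w i))
          (\<lambda>w. (\<forall>i<N. w i \<ge> 0) \<and> (\<Sum>i<N. w i) \<le> s t / 2)
          (\<lambda>i. z i t) \<and>
        (\<forall>i<N. x i t = s t / (2 * real N) + z i t))"

text \<open>The supremum defining the optimum is over a nonempty set of reals that is bounded above.\<close>

lemma nash_welfare_bdd_above:
  assumes "valid_instance N T s v"
  shows "bdd_above (nash_welfare N T v ` {x. allocation N T s x})"
proof (rule bdd_aboveI2)
  fix x assume "x \<in> {x. allocation N T s x}"
  then have x: "\<And>i t. i < N \<Longrightarrow> t < T \<Longrightarrow> 0 \<le> x i t"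
    and xs: "\<And>t. t < T \<Longrightarrow> (\<Sum>i<N. x i t) \<le> s t"
    by (auto simp: allocation_def)
  have v: "\<And>i t. i < N \<Longrightarrow> t < T \<Longrightarrow> 0 \<le> v i t" and N: "N > 0"
    using assms by (auto simp: valid_instance_def)
  have le: "x i t \<le> s t" if "i < N" "t < T" for i t
  proof -
    have "x i t \<le> (\<Sum>i<N. x i t)"
      by (rule member_le_sum) (use that x in auto)
    with xs[OF that(2)] show ?thesis by simp
  qed
  have "(\<Prod>i<N. utility T v x i) \<le> (\<Prod>i<N. \<Sum>t<T. s t * v i t)"
    unfolding utility_def
    by (intro prod_mono conjI sum_nonneg sum_mono mult_right_mono) (auto simp: x v le)
  then show "nash_welfare N T v x \<le> root N (\<Prod>i<N. \<Sum>t<T. s t * v i t)"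
    unfolding nash_welfare_def using N by simp
qed

lemma allocation_nonempty:
  assumes "valid_instance N T s v"
  shows "{x. allocation N T s x} \<noteq> {}"
proof -
  have "allocation N T s (\<lambda>_ _. 0)"
    using assms by (auto simp: allocation_def valid_instance_def less_imp_le)
  then show ?thesis by blast
qed

text \<open>
  Competitiveness with ratio \<open>O (log (lam * N))\<close> cannot be read as a bound \<open>C * ln (lam * N)\<close> for all
  parameters, since \<open>ln (lam * N)\<close> is 0 at \<open>N = lam = 1\<close>, where the ratio is 1. The bound
  \<open>C * max 1 (ln (lam * N))\<close> covers all parameters. It is \<open>C * ln (lam * N)\<close> itself as soon as
  \<open>lam * N \<ge> exp 1\<close>, and at most \<open>(C / ln 2) * ln (lam * N)\<close> whenever \<open>lam * N \<ge> 2\<close>, in particular for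
  all \<open>N \<ge> 2\<close>.
\<close>

definition log_ratio :: "real \<Rightarrow> nat \<Rightarrow> real" where
  "log_ratio lam N = max 1 (ln (lam * real N))"

end

theory Submission
  imports Defs "HOL-Analysis.Convex"
begin

text \<open>
  Let \<open>S\<close> be the total value \<open>\<Sum>i t. s t * v i t\<close> and \<open>c = 1 / (2 * lam * N\<^sup>2)\<close>. Balance makes
  \<open>c * S\<close> a lower bound for the utility \<open>U i\<close> that the algorithm gives to agent \<open>i\<close>. Split the items at
  the point where the value seen so far exceeds \<open>c * S\<close>. The earlier items contribute at most
  \<open>c * S \<le> U i\<close> to any agent in any allocation \<open>y\<close>. For a later item \<open>t\<close>, the first-order optimality
  condition for \<open>z\<close>, tested against half of \<open>y\<close>, bounds \<open>\<Sum>i. y i t * v i t / U i\<close> by twice the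
  sum over \<open>i\<close> of the relative increments of the predicted utilities. These telescope to a logarithm,
  and since the predictions for later items lie between \<open>c\<^sup>2 * S\<close> and \<open>S\<close>, it is at most
  \<open>ln (1 / c\<^sup>2)\<close>. Hence the average of \<open>utility y i / U i\<close> is \<open>O(log (lam * N))\<close>, and the claim
  follows from the inequality of arithmetic and geometric means.
\<close>

text \<open>The feasible set is convex, so a short move from \<open>z\<close> towards
  \<open>w\<close> stays feasible and the objective cannot increase along it. Its directional
  derivative at \<open>z\<close>, which is the difference of the two sums, is therefore not
  positive.\<close>

lemma log_welfare_maximizer_first_order:
  fixes a b z w :: "'i \<Rightarrow> real"
  assumes max: "is_arg_max (\<lambda>w. \<Sum>i\<in>I. ln (a i + b i * w i))
                  (\<lambda>w. (\<forall>i\<in>I. w i \<ge> 0) \<and> (\<Sum>i\<in>I. w i) \<le> r) z"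
    and a: "\<And>i. i \<in> I \<Longrightarrow> a i > 0" and b: "\<And>i. i \<in> I \<Longrightarrow> b i \<ge> 0"
    and w: "\<And>i. i \<in> I \<Longrightarrow> w i \<ge> 0" "(\<Sum>i\<in>I. w i) \<le> r"
  shows "(\<Sum>i\<in>I. b i * w i / (a i + b i * z i)) \<le> (\<Sum>i\<in>I. b i * z i / (a i + b i * z i))"
proof (rule ccontr)
  assume contra: "\<not> ?thesis"
  define g where "g e = (\<Sum>i\<in>I. ln (a i + b i * (z i + e * (w i - z i))))" for e :: real
  define D where "D = (\<Sum>i\<in>I. b i * (w i - z i) / (a i + b i * z i))"
  have z: "\<And>i. i \<in> I \<Longrightarrow> z i \<ge> 0" "(\<Sum>i\<in>I. z i) \<le> r"
    and opt: "\<And>w. (\<forall>i\<in>I. w i \<ge> 0) \<Longrightarrow> (\<Sum>i\<in>I. w i) \<le> r \<Longrightarrow>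
           (\<Sum>i\<in>I. ln (a i + b i * w i)) \<le> (\<Sum>i\<in>I. ln (a i + b i * z i))"
    using max by (auto simp: is_arg_max_linorder)
  have "(g has_real_derivative D) (at 0)"
    unfolding g_def D_def
  proof (rule DERIV_sum)
    fix i assume i: "i \<in> I"
    have "a i + b i * z i > 0" using a[OF i] b[OF i] z(1)[OF i] by (simp add: add_pos_nonneg)
    then show "((\<lambda>e. ln (a i + b i * (z i + e * (w i - z i)))) has_real_derivative
        b i * (w i - z i) / (a i + b i * z i)) (at 0)"
      by (auto intro!: derivative_eq_intros)
  qed
  moreover have "D > 0"
    using contra by (simp add: D_def right_diff_distrib diff_divide_distrib sum_subtractf)
  ultimately obtain d where d: "d > 0" "\<And>h. h > 0 \<Longrightarrow> h < d \<Longrightarrow> g 0 < g (0 + h)"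
    using DERIV_pos_inc_right by blast
  \<comment> \<open>The cap at 1 makes \<open>z i + h * (w i - z i)\<close> a convex combination;
    halving \<open>d\<close> keeps \<open>h\<close> strictly below it.\<close>
  define h where "h = min (d / 2) 1"
  have h: "0 < h" "h < d" "h \<le> 1" using d(1) by (auto simp: h_def)
  have conv: "z i + h * (w i - z i) = (1 - h) * z i + h * w i" for i by (simp add: algebra_simps)
  have "(\<Sum>i\<in>I. (1 - h) * z i + h * w i) = (1 - h) * (\<Sum>i\<in>I. z i) + h * (\<Sum>i\<in>I. w i)"
    by (simp add: sum.distrib sum_distrib_left)
  also have "\<dots> \<le> (1 - h) * r + h * r"
    using h w z by (intro add_mono mult_left_mono) auto
  also have "\<dots> = r" by (simp add: algebra_simps)
  finally have "g h \<le> g 0"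
    using opt[of "\<lambda>i. z i + h * (w i - z i)"] h w z by (simp add: g_def conv)
  with d(2)[OF h(1,2)] show False by simp
qed

text \<open>By \<open>1 - u \<le> - ln u\<close>, each relative increment is at most the increment
  of the logarithm of the running total \<open>L\<close>, and these telescope. Since
  \<open>L m \<ge> a\<close>, the starting value can be replaced by \<open>a\<close>, which does not
  depend on \<open>m\<close>.\<close>

lemma sum_relative_increments_le_ln:
  fixes d :: "nat \<Rightarrow> real"
  assumes a: "a > 0" and d: "\<And>t. t < n \<Longrightarrow> d t \<ge> 0" and mn: "m \<le> n"
  shows "(\<Sum>t=m..<n. d t / (a + (\<Sum>k\<le>t. d k))) \<le> ln ((a + (\<Sum>k<n. d k)) / a)"
proof -
  define L where "L t = a + (\<Sum>k<t. d k)" for t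
  have L: "L t \<ge> a" if "t \<le> n" for t
    using that d by (auto simp: L_def intro!: sum_nonneg)
  have "(\<Sum>t=m..<n. d t / (a + (\<Sum>k\<le>t. d k))) \<le> (\<Sum>t=m..<n. ln (L (Suc t)) - ln (L t))"
  proof (rule sum_mono)
    fix t assume "t \<in> {m..<n}"
    then have pos: "L t > 0" "L (Suc t) > 0" using L[of t] L[of "Suc t"] a by auto
    have "d t / (a + (\<Sum>k\<le>t. d k)) = 1 - L t / L (Suc t)"
      using pos by (simp add: L_def lessThan_Suc_atMost [symmetric] field_simps)
    also have "\<dots> \<le> - ln (L t / L (Suc t))"
      using ln_le_minus_one[of "L t / L (Suc t)"] pos by simp
    also have "\<dots> = ln (L (Suc t)) - ln (L t)" using pos by (simp add: ln_div)
    finally show "d t / (a + (\<Sum>k\<le>t. d k)) \<le> ln (L (Suc t)) - ln (L t)" .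
  qed
  also have "\<dots> = ln (L n) - ln (L m)" by (rule sum_Suc_diff'[OF mn])
  also have "\<dots> \<le> ln (L n) - ln a" using L[OF mn] a by simp
  also have "\<dots> = ln (L n / a)" using L[of n] a by (simp add: ln_div)
  finally show ?thesis by (simp add: L_def)
qed

lemma sum_utility_ratios_le:
  assumes valid: "valid_instance N T s v" and lam: "lam \<ge> 1" and bal: "balanced lam N T s v"
    and alg: "half_and_half lam N T s v x" and y: "allocation N T s y"
    and pos: "(\<Sum>i<N. \<Sum>t<T. v i t * s t) > 0"
  shows "(\<forall>i<N. utility T v x i > 0) \<and>
    (\<Sum>i<N. utility T v y i / utility T v x i) \<le> real N * (1 + 4 * ln (2 * lam * (real N)\<^sup>2))"
proof -
  have N: "N \<ge> 1" and s: "\<And>t. t < T \<Longrightarrow> s t > 0" and v: "\<And>i t. i < N \<Longrightarrow> t < T \<Longrightarrow> v i t \<ge> 0"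
    using valid by (auto simp: valid_instance_def)
  have y0: "\<And>i t. i < N \<Longrightarrow> t < T \<Longrightarrow> y i t \<ge> 0" and ysum: "\<And>t. t < T \<Longrightarrow> (\<Sum>i<N. y i t) \<le> s t"
    using y by (auto simp: allocation_def)
  define c where "c = 1 / (2 * lam * (real N)\<^sup>2)"
  define S where "S n = (\<Sum>j<N. \<Sum>t<n. v j t * s t)" for n
  define V where "V i = (\<Sum>t<T. v i t * s t)" for i
  define U where "U i = utility T v x i" for i
  obtain z where
    zmax: "\<And>t. t < T \<Longrightarrow> is_arg_max
          (\<lambda>w. \<Sum>i<N. ln (predicted_utility lam N s v z i t + v i t * w i))
          (\<lambda>w. (\<forall>i<N. w i \<ge> 0) \<and> (\<Sum>i<N. w i) \<le> s t / 2)
          (\<lambda>i. z i t)"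
    and x: "\<And>t i. t < T \<Longrightarrow> i < N \<Longrightarrow> x i t = s t / (2 * real N) + z i t"
    using alg unfolding half_and_half_def by blast
  have z0: "\<And>i t. i < N \<Longrightarrow> t < T \<Longrightarrow> z i t \<ge> 0"
    and zsum: "\<And>t. t < T \<Longrightarrow> (\<Sum>i<N. z i t) \<le> s t / 2"
    using zmax by (auto simp: is_arg_max_linorder)
  have zle: "z i t \<le> s t / 2" if "i < N" "t < T" for i t
    using member_le_sum[of i "{..<N}" "\<lambda>i. z i t"] zsum[OF that(2)] that z0 by fastforce
  have yle: "y i t \<le> s t" if "i < N" "t < T" for i t
    using member_le_sum[of i "{..<N}" "\<lambda>i. y i t"] ysum[OF that(2)] that y0 by fastforce
  have N2: "(real N)\<^sup>2 \<ge> 1" using N by simp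
  have lamN: "lam * (real N)\<^sup>2 \<ge> 1" using mult_mono[OF lam N2] lam by simp
  have c: "0 < c" "c \<le> 1 / 2" using lamN by (auto simp: c_def field_simps)
  have Smono: "S m \<le> S n" if "m \<le> n" "n \<le> T" for m n
    unfolding S_def using that s v by (intro sum_mono sum_mono2) (auto simp: less_imp_le)
  have ST: "S T = (\<Sum>i<N. V i)" by (simp add: S_def V_def)
  have STpos: "S T > 0" using pos by (simp add: S_def)
  have V0: "V i \<ge> 0" if "i < N" for i
    unfolding V_def using that s v by (intro sum_nonneg) (auto simp: less_imp_le)
  have VS: "V i \<le> S T" if "i < N" for i
    unfolding ST using that V0 by (intro member_le_sum) auto
  have U: "U i = V i / (2 * real N) + (\<Sum>t<T. v i t * z i t)" if "i < N" for i
  proof -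
    have "U i = (\<Sum>t<T. v i t * s t / (2 * real N) + v i t * z i t)"
      unfolding U_def utility_def using that by (intro sum.cong) (auto simp: x algebra_simps)
    then show ?thesis by (simp add: V_def sum.distrib sum_divide_distrib)
  qed
  \<comment> \<open>Summing balance over all agents gives \<open>S T \<le> N * lam * V i\<close>,
    and \<open>c * N * lam = 1 / (2 * N)\<close>. The right-hand side is the value of agent
    \<open>i\<close>'s equal share of half the supply.\<close>
  have cV: "c * S T \<le> V i / (2 * real N)" if "i < N" for i
  proof -
    have "S T \<le> (\<Sum>j<N. lam * V i)"
      unfolding ST using bal that
      by (intro sum_mono) (auto simp: balanced_def V_def mult.commute)
    then have "c * S T \<le> c * (real N * (lam * V i))"
      using c by (intro mult_left_mono) auto
    also have "\<dots> = V i / (2 * real N)"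
      using N lam by (simp add: c_def power2_eq_square)
    finally show ?thesis .
  qed
  have cU: "c * S T + (\<Sum>t<T. v i t * z i t) \<le> U i" if "i < N" for i
    using cV[OF that] U[OF that] by simp
  have Z0: "(\<Sum>t<n. v i t * z i t) \<ge> 0" if "i < N" "n \<le> T" for i n
    using that v z0 by (intro sum_nonneg) auto
  have cU': "c * S T \<le> U i" if "i < N" for i
    using cU[OF that] Z0[OF that, of T] by simp
  have Upos: "U i > 0" if "i < N" for i
    using cU'[OF that] c(1) STpos mult_pos_pos[of c "S T"] by linarith
  have US: "U i \<le> S T" if "i < N" for i
  proof -
    have "(\<Sum>t<T. v i t * z i t) \<le> (\<Sum>t<T. v i t * (s t / 2))"
      using that v zle by (intro sum_mono mult_left_mono) auto
    also have "\<dots> = V i / 2" by (simp add: V_def sum_divide_distrib)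
    finally have "U i \<le> V i / (2 * real N) + V i / 2" using U[OF that] by simp
    also have "V i / (2 * real N) \<le> V i / 2"
      using N V0[OF that] by (intro divide_left_mono) auto
    finally show ?thesis using VS[OF that] by simp
  qed

  have "c * S T < S T" using c STpos by (simp add: field_simps)
  moreover have "\<not> c * S T < S 0" using mult_pos_pos[OF c(1) STpos] by (simp add: S_def [of 0])
  \<comment> \<open>Item \<open>k\<close> is the one whose arrival lifts the seen value above
    \<open>c * S T\<close>. It is counted among the later items, so predictions there already
    contain \<open>S (Suc k)\<close>.\<close>
  ultimately obtain k where k: "k < T" "S k \<le> c * S T" "c * S T < S (Suc k)"
    using ex_least_nat_less[of "\<lambda>n. c * S T < S n" T] by (auto simp: not_less)

  have pred: "predicted_utility lam N s v z i t = c * S (Suc t) + (\<Sum>t'<t. v i t' * z i t')" for i t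
    by (simp add: predicted_utility_def c_def S_def lessThan_Suc_atMost)
  \<comment> \<open>The first term of the prediction grows with \<open>t\<close>. Its value at item
    \<open>k\<close> bounds it from below for all later items and serves as a fixed base for
    telescoping.\<close>
  define a where "a = c * S (Suc k)"
  have "c * (c * S T) \<le> a" unfolding a_def using c k by (intro mult_left_mono) auto
  moreover have "c * (c * S T) > 0" using c STpos by simp
  ultimately have a: "a > 0" "c\<^sup>2 * S T \<le> a" by (auto simp: power2_eq_square)

  \<comment> \<open>\<open>R i t\<close> is the predicted utility once item \<open>t\<close> has
    been handed out, the denominator in the first-order condition.\<close>
  define R where "R i t = predicted_utility lam N s v z i t + v i t * z i t" for i t
  have R: "R i t = c * S (Suc t) + (\<Sum>t'\<le>t. v i t' * z i t')" for i t
    by (simp add: R_def pred lessThan_Suc_atMost [symmetric])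
  have aR: "a + (\<Sum>t'\<le>t. v i t' * z i t') \<le> R i t" if "k \<le> t" "t < T" for i t
    unfolding R a_def using that c Smono[of "Suc k" "Suc t"] by simp
  have Rpos: "R i t > 0" if "i < N" "k \<le> t" "t < T" for i t
    using aR[of t i] Z0[of i "Suc t"] that a by (simp add: lessThan_Suc_atMost)
  have RU: "R i t \<le> U i" if "i < N" "t < T" for i t
  proof -
    have "c * S (Suc t) \<le> c * S T" using that c Smono[of "Suc t" T] by simp
    moreover have "(\<Sum>t'\<le>t. v i t' * z i t') \<le> (\<Sum>t'<T. v i t' * z i t')"
      using that v z0 by (intro sum_mono2) auto
    ultimately show ?thesis using cU[OF that(1)] by (simp add: R)
  qed

  have early: "(\<Sum>t<k. y i t * v i t) \<le> U i" if i: "i < N" for i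
  proof -
    have "(\<Sum>t<k. y i t * v i t) \<le> (\<Sum>t<k. v i t * s t)"
      using i k v yle by (intro sum_mono) (auto simp: mult.commute [of "v i _"] intro!: mult_right_mono)
    also have "\<dots> \<le> S k"
      unfolding S_def using i k s v
      by (intro member_le_sum[of i "{..<N}" "\<lambda>j. \<Sum>t<k. v j t * s t"] sum_nonneg)
        (auto simp: less_imp_le)
    finally show ?thesis using k cU'[OF i] by simp
  qed

  have late: "(\<Sum>i<N. y i t * v i t / U i) \<le> 2 * (\<Sum>i<N. v i t * z i t / R i t)"
    if t: "k \<le> t" "t < T" for t
  proof -
    have "a \<le> c * S (Suc t)" unfolding a_def using t c Smono[of "Suc k" "Suc t"] by simp
    then have pp: "predicted_utility lam N s v z i t > 0" if "i < N" for i
      using t a Z0[of i t] that by (simp add: pred add_pos_nonneg)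
    have "(\<Sum>i<N. y i t * v i t / U i) \<le> (\<Sum>i<N. y i t * v i t / R i t)"
      using t RU Rpos y0 v Upos by (intro sum_mono divide_left_mono) auto
    \<comment> \<open>Only half the supply is available to \<open>z\<close>, so \<open>y\<close> is
      halved to become a feasible competitor.\<close>
    also have "\<dots> = 2 * (\<Sum>i<N. v i t * (y i t / 2) / R i t)"
      by (simp add: sum_distrib_left mult.commute)
    also have "(\<Sum>i<N. v i t * (y i t / 2) / R i t) \<le> (\<Sum>i<N. v i t * z i t / R i t)"
      unfolding R_def
    proof (rule log_welfare_maximizer_first_order)
      show "is_arg_max
          (\<lambda>w. \<Sum>i<N. ln (predicted_utility lam N s v z i t + v i t * w i))
          (\<lambda>w. (\<forall>i\<in>{..<N}. w i \<ge> 0) \<and> (\<Sum>i<N. w i) \<le> s t / 2)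
          (\<lambda>i. z i t)" using zmax[OF t(2)] by (simp add: Ball_def)
    qed (use pp v y0 ysum t in \<open>auto simp flip: sum_divide_distrib\<close>)
    finally show ?thesis by simp
  qed

  have increments: "(\<Sum>t=k..<T. v i t * z i t / R i t) \<le> 2 * ln (2 * lam * (real N)\<^sup>2)"
    if i: "i < N" for i
  proof -
    let ?Z = "\<Sum>t<T. v i t * z i t"
    have "(\<Sum>t=k..<T. v i t * z i t / R i t)
        \<le> (\<Sum>t=k..<T. v i t * z i t / (a + (\<Sum>t'\<le>t. v i t' * z i t')))"
    proof (intro sum_mono divide_left_mono mult_pos_pos)
      fix t assume t: "t \<in> {k..<T}"
      show "a + (\<Sum>t'\<le>t. v i t' * z i t') \<le> R i t" using aR t by simp
      show "0 \<le> v i t * z i t" using v z0 i t by simp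
      show "0 < a + (\<Sum>t'\<le>t. v i t' * z i t')"
        using Z0[of i "Suc t"] i t a by (simp add: lessThan_Suc_atMost add_pos_nonneg)
      show "0 < R i t" using Rpos i t by simp
    qed
    also have "\<dots> \<le> ln ((a + ?Z) / a)"
      using a k i v z0 by (intro sum_relative_increments_le_ln) auto
    also have "\<dots> \<le> ln ((1 / c)\<^sup>2)"
    proof (rule ln_mono)
      have "a \<le> c * S T" unfolding a_def using c k Smono[of "Suc k" T] by simp
      \<comment> \<open>The numerator is at most \<open>c * S T + ?Z \<le> U i \<le> S T\<close>,
        while \<open>a \<ge> c\<^sup>2 * S T\<close>.\<close>
      then have "a + ?Z \<le> S T" using cU[OF i] US[OF i] by simp
      also have "S T \<le> (1 / c)\<^sup>2 * a" using a c by (simp add: field_simps)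
      finally show "(a + ?Z) / a \<le> (1 / c)\<^sup>2" using a by (simp add: divide_le_eq)
      show "(a + ?Z) / a > 0" using a Z0[OF i, of T] by (simp add: add_pos_nonneg)
    qed
    also have "\<dots> = 2 * ln (1 / c)" using c by (simp add: ln_realpow)
    finally show ?thesis by (simp add: c_def)
  qed

  have "utility T v y i / U i = (\<Sum>t<k. y i t * v i t) / U i + (\<Sum>t=k..<T. y i t * v i t / U i)"
    for i
  proof -
    have "utility T v y i = (\<Sum>t<k. y i t * v i t) + (\<Sum>t=k..<T. y i t * v i t)"
      unfolding utility_def lessThan_atLeast0 using k by (subst sum.atLeastLessThan_concat) auto
    then show ?thesis by (simp add: add_divide_distrib sum_divide_distrib)
  qed
  \<comment> \<open>The bound \<open>late\<close> holds per item after summing over agents, whereas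
    \<open>increments\<close> holds per agent after summing over items, so the order of summation is
    exchanged once for each.\<close>
  then have "(\<Sum>i<N. utility T v y i / U i)
      = (\<Sum>i<N. (\<Sum>t<k. y i t * v i t) / U i) + (\<Sum>t=k..<T. \<Sum>i<N. y i t * v i t / U i)"
    by (simp add: sum.distrib sum.swap[of _ "{k..<T}"])
  also have "\<dots> \<le> (\<Sum>i<N. 1) + (\<Sum>t=k..<T. 2 * (\<Sum>i<N. v i t * z i t / R i t))"
    using early Upos late by (intro add_mono sum_mono) auto
  also have "\<dots> = real N + 2 * (\<Sum>i<N. \<Sum>t=k..<T. v i t * z i t / R i t)"
    by (simp add: sum_distrib_left [symmetric] sum.swap[of _ "{k..<T}"])
  also have "\<dots> \<le> real N + 2 * (\<Sum>i<N. 2 * ln (2 * lam * (real N)\<^sup>2))"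
    using increments by (intro add_mono mult_left_mono sum_mono) auto
  also have "\<dots> = real N * (1 + 4 * ln (2 * lam * (real N)\<^sup>2))" by (simp add: algebra_simps)
  finally show ?thesis using Upos by (simp add: U_def)
qed

text \<open>Since \<open>lam \<le> lam\<^sup>2\<close> and \<open>ln 2 \<le> 1\<close>, the left
  side is at most \<open>5 + 8 * ln (lam * N)\<close>, and \<open>5 + 8 = 13\<close>.\<close>

lemma ln_two_mult_square_le_log_ratio:
  assumes "N \<ge> 1" "lam \<ge> 1"
  shows "1 + 4 * ln (2 * lam * (real N)\<^sup>2) \<le> 13 * log_ratio lam N"
proof -
  have "2 * lam * (real N)\<^sup>2 \<le> 2 * (lam * real N)\<^sup>2"
    using assms self_le_power[of lam 2] by (simp add: power_mult_distrib mult_right_mono)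
  then have "ln (2 * lam * (real N)\<^sup>2) \<le> ln (2 * (lam * real N)\<^sup>2)"
    using assms by (intro ln_mono) auto
  also have "\<dots> = ln 2 + 2 * ln (lam * real N)"
    using assms by (simp add: ln_mult ln_realpow)
  finally show ?thesis
    using ln_le_minus_one[of "2 :: real"] by (simp add: log_ratio_def max_def split: if_splits)
qed

lemma nash_welfare_le:
  assumes valid: "valid_instance N T s v" and lam: "lam \<ge> 1" and bal: "balanced lam N T s v"
    and alg: "half_and_half lam N T s v x" and y: "allocation N T s y"
  shows "nash_welfare N T v y \<le> 13 * log_ratio lam N * nash_welfare N T v x"
proof (cases "(\<Sum>i<N. \<Sum>t<T. v i t * s t) > 0")
  case True
  have N: "N \<ge> 1" using valid by (simp add: valid_instance_def)
  have Upos: "\<And>i. i < N \<Longrightarrow> utility T v x i > 0"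
    and ratios: "(\<Sum>i<N. utility T v y i / utility T v x i)
        \<le> real N * (1 + 4 * ln (2 * lam * (real N)\<^sup>2))"
    using sum_utility_ratios_le[OF assms True] by auto
  have y0: "utility T v y i \<ge> 0" if "i < N" for i
    using that valid y
    by (auto simp: utility_def valid_instance_def allocation_def intro!: sum_nonneg)
  have "nash_welfare N T v y / nash_welfare N T v x
      = root N (\<Prod>i<N. utility T v y i / utility T v x i)"
    by (simp add: nash_welfare_def real_root_divide prod_dividef)
  also have "\<dots> = (\<Prod>i<N. utility T v y i / utility T v x i) powr (1 / real N)"
    using N Upos y0 by (intro root_powr_inverse) (auto intro!: prod_nonneg simp: less_imp_le)
  also have "\<dots> \<le> (\<Sum>i<N. utility T v y i / utility T v x i) / real N"
    using arith_geom_mean[of "{..<N}" "\<lambda>i. utility T v y i / utility T v x i"] N Upos y0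
    by (auto simp: lessThan_empty_iff less_imp_le sum_divide_distrib)
  also have "\<dots> \<le> 1 + 4 * ln (2 * lam * (real N)\<^sup>2)"
    using ratios N by (simp add: divide_le_eq mult.commute)
  also have "\<dots> \<le> 13 * log_ratio lam N"
    by (rule ln_two_mult_square_le_log_ratio[OF N lam])
  finally have "nash_welfare N T v y / nash_welfare N T v x \<le> 13 * log_ratio lam N" .
  moreover have "nash_welfare N T v x > 0"
    unfolding nash_welfare_def using N Upos by (auto intro!: prod_pos)
  ultimately show ?thesis by (simp add: divide_le_eq)
next
  \<comment> \<open>Without any value both welfares are 0, so the claim holds without forming their
    quotient.\<close>
  case False
  have N: "N \<ge> 1" using valid by (simp add: valid_instance_def)
  have nn: "\<And>i t. i < N \<Longrightarrow> t < T \<Longrightarrow> v i t * s t \<ge> 0" and s: "\<And>t. t < T \<Longrightarrow> s t > 0"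
    using valid by (auto simp: valid_instance_def less_imp_le)
  have "(\<Sum>i<N. \<Sum>t<T. v i t * s t) = 0"
    using False nn by (intro antisym sum_nonneg) auto
  moreover have "(\<Sum>t<T. v i t * s t) \<ge> 0" if "i < N" for i
    using that nn by (intro sum_nonneg) auto
  ultimately have "(\<Sum>t<T. v i t * s t) = 0" if "i < N" for i
    using that sum_nonneg_eq_0_iff[of "{..<N}" "\<lambda>i. \<Sum>t<T. v i t * s t"] by simp
  then have "v i t * s t = 0" if "i < N" "t < T" for i t
    using that nn sum_nonneg_eq_0_iff[of "{..<T}" "\<lambda>t. v i t * s t"] by simp
  then have "v i t = 0" if "i < N" "t < T" for i t
    using that s[of t] by fastforce
  then have "nash_welfare N T v w = 0" for w
    using N by (simp add: nash_welfare_def utility_def)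
  then show ?thesis by simp
qed

theorem theorem1:
  "\<exists>C>0. \<forall>N T (s :: nat \<Rightarrow> real) (v :: nat \<Rightarrow> nat \<Rightarrow> real) (lam :: real) (x :: nat \<Rightarrow> nat \<Rightarrow> real).
     valid_instance N T s v \<longrightarrow> lam \<ge> 1 \<longrightarrow> balanced lam N T s v \<longrightarrow>
     half_and_half lam N T s v x \<longrightarrow>
     opt_nash_welfare N T s v \<le> C * log_ratio lam N * nash_welfare N T v x"
proof (intro exI[of _ 13] conjI allI impI)
  fix N T s v lam x
  assume *: "valid_instance N T s v" "lam \<ge> 1" "balanced lam N T s v" "half_and_half lam N T s v x"
  then show "opt_nash_welfare N T s v \<le> 13 * log_ratio lam N * nash_welfare N T v x"
    unfolding opt_nash_welfare_def
    by (intro cSUP_least) (use allocation_nonempty nash_welfare_le in blast)+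
qed simp

end
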